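(* Let $n>75$ be even. 1. If $S_{2n+2}$ is a Steiner quadruple system of order $2n+2$ and $B_n$ is a $3$-BBD$(n)$, then there exists a Steiner quadruple system $S_{8n+2}$ of order $8n+2$ containing both $S_{2n+2}$ and $B_n$ (i.e. there are injections of the point sets of $S_{2n+2}$ and of $B_n$ into the point set of $S_{8n+2}$ mapping every block of $S_{2n+2}$ and every block of $B_n$ onto a block of $S_{8n+2}$). 2. If $S_{2n+2}\in S(3,\{4,6\},2n+2)$ and $B_n$ is a $3$-BBD$(n)$, then there exists $S_{8n+2}\in S(3,\{4,6\},8n+2)$ containing both $S_{2n+2}$ and $B_n$ in the same sense.
   Context: A Steiner quadruple system of order $v$ (an element of $S(3,4,v)$) is a set of $4$-element subsets (blocks) of a $v$-element set $X$ such that every $3$-element subset of $X$ lies in exactly one block. $S(3,\{4,6\},v)$ denotes the set of $3$-wise balanced designs on a $v$-element set $X$ with all blocks of size $4$ or $6$, i.e. collections of $4$- and $6$-element subsets of $X$ such that every $3$-element subset of $X$ lies in exactly one block. A $3$-BBD$(n)$ is a triple $(X,\{g_1,g_2\},B)$ with $|X|=n$, $\{g_1,g_2\}$ a partition of $X$ into two equal parts, $B$ a set of $4$-subsets of $X$ each meeting $g_1$ and $g_2$ in exactly two points, such that every $3$-subset of $X$ meeting both $g_1$ and $g_2$ lies in exactly one block. *)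

theory Defs
  imports Main
begin

definition wbd3 :: "'a set \<Rightarrow> nat set \<Rightarrow> 'a set set \<Rightarrow> bool" where
  "wbd3 X K B \<longleftrightarrow> finite X \<and> (\<forall>b\<in>B. b \<subseteq> X \<and> card b \<in> K) \<and>
     (\<forall>T. T \<subseteq> X \<and> card T = 3 \<longrightarrow> (\<exists>!b. b \<in> B \<and> T \<subseteq> b))"

definition SQS :: "nat \<Rightarrow> 'a set \<Rightarrow> 'a set set \<Rightarrow> bool" where
  "SQS v X B \<longleftrightarrow> card X = v \<and> wbd3 X {4} B"

definition S346 :: "nat \<Rightarrow> 'a set \<Rightarrow> 'a set set \<Rightarrow> bool" where
  "S346 v X B \<longleftrightarrow> card X = v \<and> wbd3 X {4,6} B"

definition BBD3 :: "nat \<Rightarrow> 'a set \<Rightarrow> 'a set \<Rightarrow> 'a set \<Rightarrow> 'a set set \<Rightarrow> bool" where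
  "BBD3 n X g1 g2 B \<longleftrightarrow> finite X \<and> card X = n \<and> g1 \<union> g2 = X \<and> g1 \<inter> g2 = {} \<and>
     card g1 = card g2 \<and>
     (\<forall>b\<in>B. b \<subseteq> X \<and> card b = 4 \<and> card (b \<inter> g1) = 2 \<and> card (b \<inter> g2) = 2) \<and>
     (\<forall>T. T \<subseteq> X \<and> card T = 3 \<and> T \<inter> g1 \<noteq> {} \<and> T \<inter> g2 \<noteq> {} \<longrightarrow>
        (\<exists>!b. b \<in> B \<and> T \<subseteq> b))"

definition embeds :: "'a set \<Rightarrow> 'a set set \<Rightarrow> 'b set \<Rightarrow> 'b set set \<Rightarrow> bool" where
  "embeds X B Y C \<longleftrightarrow> (\<exists>f. inj_on f X \<and> f ` X \<subseteq> Y \<and> (\<forall>b\<in>B. f ` b \<in> C))"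

end

theory Submission
  imports Defs
begin

text \<open>
  This is Hanani's construction \<open>v \<mapsto> 4v - 6\<close> with \<open>v = 2n + 2\<close>. The points are two points at infinity
  and four groups \<open>(h, i)\<close>, each a copy of the integers modulo \<open>2n\<close>. A copy of the given system
  is put on each group together with infinity. The triples meeting \<open>(h, 0)\<close> and \<open>(h, 1)\<close> only are covered by
  blocks that have two points in each; such a bipartite system comes from the given 3-BBD
  by multiplying both of its parts by \<open>\<int>\<^sub>2 \<times> \<int>\<^sub>2\<close>. The remaining triples are covered by blocks with \<open>x\<close> in \<open>(h, 0)\<close>,
  \<open>y\<close> in \<open>(h, 1)\<close> and \<open>z, w\<close> in a group \<open>(1 - h, j)\<close>, where \<open>z + w \<equiv> x + y \<plusminus> j\<close> modulo \<open>2n\<close>. When \<open>z = w\<close> the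
  fourth point is replaced by a point at infinity. For given \<open>x, y\<close> this happens for two
  values \<open>z\<close> differing by \<open>n\<close>, which receive different points at infinity.
\<close>

section \<open>Families of blocks covering families of triples\<close>

text \<open>Exact in both directions: a block may not produce triples outside the family. This makes
  systems for disjoint families of triples compatible without any comparison of their
  blocks.\<close>

definition covers :: "'a set set \<Rightarrow> 'a set set \<Rightarrow> bool" where
  "covers F \<T> \<longleftrightarrow> (\<forall>b\<in>F. \<forall>T. T \<subseteq> b \<and> card T = 3 \<longrightarrow> T \<in> \<T>) \<and>
     (\<forall>T\<in>\<T>. card T = 3 \<and> (\<exists>!b. b \<in> F \<and> T \<subseteq> b))"

lemma coversD:
  assumes "covers F \<T>"
  shows "b \<in> F \<Longrightarrow> T \<subseteq> b \<Longrightarrow> card T = 3 \<Longrightarrow> T \<in> \<T>"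
    and "T \<in> \<T> \<Longrightarrow> card T = 3"
    and "T \<in> \<T> \<Longrightarrow> \<exists>!b. b \<in> F \<and> T \<subseteq> b"
  using assms unfolding covers_def by auto

text \<open>A block of another index through \<open>T\<close> would put \<open>T\<close> into the
  family of that index, which disjointness forbids. Hence uniqueness survives the union.\<close>

lemma covers_UN:
  assumes F: "\<And>k. k \<in> I \<Longrightarrow> covers (F k) (\<T> k)"
    and disj: "\<And>k l. \<lbrakk>k \<in> I; l \<in> I; k \<noteq> l\<rbrakk> \<Longrightarrow> \<T> k \<inter> \<T> l = {}"
  shows "covers (\<Union>k\<in>I. F k) (\<Union>k\<in>I. \<T> k)"
  unfolding covers_def
proof (intro conjI ballI allI impI)
  fix b T assume "b \<in> (\<Union>k\<in>I. F k)" and T: "T \<subseteq> b \<and> card T = 3"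
  then obtain k where "k \<in> I" "b \<in> F k" by blast
  then show "T \<in> (\<Union>k\<in>I. \<T> k)" using coversD(1)[OF F] T by blast
next
  fix T assume "T \<in> (\<Union>k\<in>I. \<T> k)"
  then obtain k where k: "k \<in> I" "T \<in> \<T> k" by blast
  show card: "card T = 3" using coversD(2)[OF F] k by blast
  obtain b where b: "b \<in> F k" "T \<subseteq> b" and uniq: "\<And>c. c \<in> F k \<Longrightarrow> T \<subseteq> c \<Longrightarrow> c = b"
    using coversD(3)[OF F[OF k(1)] k(2)] by blast
  show "\<exists>!b. b \<in> (\<Union>k\<in>I. F k) \<and> T \<subseteq> b"
  proof (rule ex1I)
    show "b \<in> (\<Union>k\<in>I. F k) \<and> T \<subseteq> b" using b k by blast
    fix c assume c: "c \<in> (\<Union>k\<in>I. F k) \<and> T \<subseteq> c"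
    then obtain l where l: "l \<in> I" "c \<in> F l" by blast
    then have "T \<in> \<T> l" using coversD(1)[OF F] c card by blast
    then have "l = k" using disj k l by blast
    then show "c = b" using uniq l c by blast
  qed
qed

lemma covers_Un:
  assumes "covers F1 T1" "covers F2 T2" "T1 \<inter> T2 = {}"
  shows "covers (F1 \<union> F2) (T1 \<union> T2)"
proof -
  have "covers (\<Union>k\<in>UNIV. if k then F1 else F2) (\<Union>k\<in>UNIV. if k then T1 else T2)"
    by (rule covers_UN) (use assms in \<open>auto split: if_splits\<close>)
  then show ?thesis by (simp add: UNIV_bool Un_commute)
qed

lemma wbd3_covers:
  assumes W: "wbd3 X K B"
  shows "covers B {T. T \<subseteq> X \<and> card T = 3}"
  unfolding covers_def
proof (intro conjI ballI allI impI)
  fix b T assume "b \<in> B" "T \<subseteq> b \<and> card T = 3"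
  moreover from this have "b \<subseteq> X" using W by (simp add: wbd3_def)
  ultimately show "T \<in> {T. T \<subseteq> X \<and> card T = 3}" by auto
next
  fix T assume T: "T \<in> {T. T \<subseteq> X \<and> card T = 3}"
  then show "card T = 3" by simp
  show "\<exists>!b. b \<in> B \<and> T \<subseteq> b" using W T by (simp add: wbd3_def)
qed

lemma covers_wbd3:
  assumes "finite X" "\<And>b. b \<in> B \<Longrightarrow> b \<subseteq> X" "\<And>b. b \<in> B \<Longrightarrow> card b \<in> K"
    and cov: "covers B {T. T \<subseteq> X \<and> card T = 3}"
  shows "wbd3 X K B"
  unfolding wbd3_def using assms(1-3) coversD(3)[OF cov] by simp

lemma wbd3_image:
  assumes W: "wbd3 X K B" and f: "inj_on f X"
  shows "wbd3 (f ` X) K ((`) f ` B)"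
  unfolding wbd3_def
proof (intro conjI ballI allI impI)
  show "finite (f ` X)" using W by (simp add: wbd3_def)
next
  fix b assume "b \<in> (`) f ` B"
  then obtain b0 where b0: "b0 \<in> B" "b = f ` b0" by blast
  then have "b0 \<subseteq> X" "card b0 \<in> K" using W by (auto simp: wbd3_def)
  then show "b \<subseteq> f ` X" "card b \<in> K"
    using b0 card_image[OF inj_on_subset[OF f]] by auto
next
  fix T assume T: "T \<subseteq> f ` X \<and> card T = 3"
  then obtain T0 where T0: "T0 \<subseteq> X" "T = f ` T0" by (meson subset_image_iff)
  then have "card T0 = 3" using T card_image[OF inj_on_subset[OF f]] by auto
  then have ex: "\<exists>!b. b \<in> B \<and> T0 \<subseteq> b" using W T0 by (auto simp: wbd3_def)
  have sub: "f ` T0 \<subseteq> f ` b \<longleftrightarrow> T0 \<subseteq> b" if "b \<in> B" for b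
  proof -
    have "b \<subseteq> X" using W that by (simp add: wbd3_def)
    then have "f x \<in> f ` b \<longleftrightarrow> x \<in> b" if "x \<in> T0" for x
      using inj_on_image_mem_iff[OF f] T0(1) that by blast
    then show ?thesis unfolding image_subset_iff subset_eq by simp
  qed
  show "\<exists>!b. b \<in> (`) f ` B \<and> T \<subseteq> b"
  proof -
    obtain b where b: "b \<in> B" "T0 \<subseteq> b" "\<And>b'. b' \<in> B \<Longrightarrow> T0 \<subseteq> b' \<Longrightarrow> b' = b"
      using ex by blast
    show ?thesis
    proof (rule ex1I)
      show "f ` b \<in> (`) f ` B \<and> T \<subseteq> f ` b" using b T0(2) by blast
      fix c assume c: "c \<in> (`) f ` B \<and> T \<subseteq> c"
      then obtain c0 where c0: "c0 \<in> B" "c = f ` c0" by blast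
      then have "T0 \<subseteq> c0" using sub[OF c0(1)] c T0(2) by simp
      then show "c = f ` b" using b(3) c0 by simp
    qed
  qed
qed

lemma embeds_trans:
  assumes "embeds X A Y B" "embeds Y B Z C"
  shows "embeds X A Z C"
proof -
  obtain f where f: "inj_on f X" "f ` X \<subseteq> Y" "\<forall>b\<in>A. f ` b \<in> B"
    using assms(1) unfolding embeds_def by blast
  obtain g where g: "inj_on g Y" "g ` Y \<subseteq> Z" "\<forall>b\<in>B. g ` b \<in> C"
    using assms(2) unfolding embeds_def by blast
  have "inj_on (g \<circ> f) X" using f g by (meson comp_inj_on inj_on_subset)
  moreover have "(g \<circ> f) ` X \<subseteq> Z" using f g by auto
  moreover have "\<forall>b\<in>A. (g \<circ> f) ` b \<in> C" using f g by (simp only: image_comp[symmetric]) simp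
  ultimately show ?thesis unfolding embeds_def by blast
qed

lemma card_3_subset_4:
  assumes "T \<subseteq> {a, b, c, d}" "card T = 3" "distinct [a, b, c, d]"
  shows "T = {a,b,c} \<or> T = {a,b,d} \<or> T = {a,c,d} \<or> T = {b,c,d}"
proof -
  have "card ({a,b,c,d} - T) = 1"
    using assms finite_subset[OF assms(1)] by (simp add: card_Diff_subset)
  then obtain e where e: "{a,b,c,d} - T = {e}" by (rule card_1_singletonE)
  then have T: "T = {a,b,c,d} - {e}" using assms(1) by blast
  have "e \<in> {a,b,c,d}" using e by blast
  then consider "e = a" | "e = b" | "e = c" | "e = d" by blast
  then show ?thesis unfolding T by cases (use assms(3) in auto)
qed

section \<open>Bipartite quadruple systems\<close>

text \<open>A relation instead of a set of blocks: the parts may have different types, and the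
  axioms become unique solvability for a fourth point. By the symmetry clauses each block occurs as
  four ordered quadruples.\<close>

definition biquad :: "'a set \<Rightarrow> 'b set \<Rightarrow> ('a \<Rightarrow> 'a \<Rightarrow> 'b \<Rightarrow> 'b \<Rightarrow> bool) \<Rightarrow> bool" where
  "biquad A B S \<longleftrightarrow>
     (\<forall>a a' b b'. S a a' b b' \<longrightarrow> {a,a'} \<subseteq> A \<and> {b,b'} \<subseteq> B \<and> a \<noteq> a' \<and> b \<noteq> b' \<and>
        S a' a b b' \<and> S a a' b' b) \<and>
     (\<forall>a a' b. {a,a'} \<subseteq> A \<and> b \<in> B \<and> a \<noteq> a' \<longrightarrow> (\<exists>!b'. S a a' b b')) \<and>
     (\<forall>a b b'. a \<in> A \<and> {b,b'} \<subseteq> B \<and> b \<noteq> b' \<longrightarrow> (\<exists>!a'. S a a' b b'))"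

lemma biquadD:
  assumes "biquad A B S"
  shows "S a a' b b' \<Longrightarrow> {a,a'} \<subseteq> A \<and> {b,b'} \<subseteq> B \<and> a \<noteq> a' \<and> b \<noteq> b' \<and> S a' a b b' \<and> S a a' b' b"
    and "{a,a'} \<subseteq> A \<Longrightarrow> b \<in> B \<Longrightarrow> a \<noteq> a' \<Longrightarrow> \<exists>!b'. S a a' b b'"
    and "a \<in> A \<Longrightarrow> {b,b'} \<subseteq> B \<Longrightarrow> b \<noteq> b' \<Longrightarrow> \<exists>!a'. S a a' b b'"
proof -
  note * = assms[unfolded biquad_def]
  show "S a a' b b' \<Longrightarrow> {a,a'} \<subseteq> A \<and> {b,b'} \<subseteq> B \<and> a \<noteq> a' \<and> b \<noteq> b' \<and> S a' a b b' \<and> S a a' b' b"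
    by (rule *[THEN conjunct1, rule_format])
  show "{a,a'} \<subseteq> A \<Longrightarrow> b \<in> B \<Longrightarrow> a \<noteq> a' \<Longrightarrow> \<exists>!b'. S a a' b b'"
    by (rule *[THEN conjunct2, THEN conjunct1, rule_format], intro conjI)
  show "a \<in> A \<Longrightarrow> {b,b'} \<subseteq> B \<Longrightarrow> b \<noteq> b' \<Longrightarrow> \<exists>!a'. S a a' b b'"
    by (rule *[THEN conjunct2, THEN conjunct2, rule_format], intro conjI)
qed

section \<open>A 3-BBD as a bipartite system\<close>

definition bbd_rel :: "'a set \<Rightarrow> 'a set \<Rightarrow> 'a set set \<Rightarrow> 'a \<Rightarrow> 'a \<Rightarrow> 'a \<Rightarrow> 'a \<Rightarrow> bool" where
  "bbd_rel g1 g2 B a a' b b' \<longleftrightarrow> {a,a',b,b'} \<in> B \<and> {a,a'} \<subseteq> g1 \<and> {b,b'} \<subseteq> g2 \<and> a \<noteq> a' \<and> b \<noteq> b'"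

lemma card_2_other:
  assumes "card s = 2" "b \<in> s"
  obtains b' where "b' \<noteq> b" "s = {b, b'}"
proof -
  obtain x y where xy: "s = {x, y}" "x \<noteq> y" using assms(1) by (auto simp: card_2_iff)
  show thesis
  proof (cases "b = x")
    case True
    then show thesis using that[of y] xy by auto
  next
    case False
    then show thesis using that[of x] xy assms(2) by auto
  qed
qed

lemma BBD3D:
  "BBD3 n X g1 g2 B \<Longrightarrow> T \<subseteq> X \<Longrightarrow> card T = 3 \<Longrightarrow> T \<inter> g1 \<noteq> {} \<Longrightarrow> T \<inter> g2 \<noteq> {} \<Longrightarrow>
    \<exists>!b. b \<in> B \<and> T \<subseteq> b"
  unfolding BBD3_def by simp

text \<open>The block through \<open>a\<close>, \<open>a'\<close>, \<open>b\<close> has two points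
  in each part, so it meets \<open>g1\<close> in \<open>{a,a'}\<close> only and \<open>g2\<close> in
  \<open>b\<close> and one further point, the required \<open>b'\<close>.\<close>

lemma bbd_rel_ex1:
  assumes B: "BBD3 n X g1 g2 B" and T: "{a,a'} \<subseteq> g1" "b \<in> g2" "a \<noteq> a'"
  shows "\<exists>!b'. bbd_rel g1 g2 B a a' b b'"
proof -
  have disj: "g1 \<inter> g2 = {}" and X: "g1 \<union> g2 = X" using B by (auto simp: BBD3_def)
  have "a \<noteq> b" "a' \<noteq> b" using disj T by auto
  then have "card {a,a',b} = 3" using T(3) by simp
  moreover have "{a,a',b} \<subseteq> X" "{a,a',b} \<inter> g1 \<noteq> {}" "{a,a',b} \<inter> g2 \<noteq> {}" using T X by auto
  ultimately have ex1: "\<exists>!c. c \<in> B \<and> {a,a',b} \<subseteq> c" by (intro BBD3D[OF B])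
  then obtain c where c: "c \<in> B" "{a,a',b} \<subseteq> c" by blast
  have cc: "c \<subseteq> X" "card (c \<inter> g1) = 2" "card (c \<inter> g2) = 2" using B c unfolding BBD3_def by auto
  have "finite (c \<inter> g1)" using cc(2) by (metis card.infinite zero_neq_numeral)
  moreover have "{a,a'} \<subseteq> c \<inter> g1" using c T by auto
  moreover have "card {a,a'} = card (c \<inter> g1)" using cc(2) T(3) by simp
  ultimately have c1: "c \<inter> g1 = {a,a'}" using card_subset_eq by metis
  have "b \<in> c \<inter> g2" using c T by auto
  then obtain b' where b': "b' \<noteq> b" "c \<inter> g2 = {b,b'}" using card_2_other[OF cc(3)] by metis
  have "c = (c \<inter> g1) \<union> (c \<inter> g2)" using cc(1) X by blast
  then have ceq: "c = {a,a',b,b'}" unfolding c1 b'(2) by auto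
  show ?thesis
  proof (rule ex1I)
    show "bbd_rel g1 g2 B a a' b b'"
      unfolding bbd_rel_def using T b' c ceq by auto
    fix b'' assume r: "bbd_rel g1 g2 B a a' b b''"
    then have "{a,a',b,b''} \<in> B" by (simp add: bbd_rel_def)
    then have "{a,a',b,b''} = c" using ex1 c by blast
    then have "b'' \<in> c \<inter> g2" using r by (auto simp: bbd_rel_def)
    then show "b'' = b'" using r unfolding b'(2) bbd_rel_def by auto
  qed
qed

lemma bbd_rel_swap: "bbd_rel g1 g2 B a a' b b' \<longleftrightarrow> bbd_rel g2 g1 B b b' a a'"
proof -
  have "{a,a',b,b'} = {b,b',a,a'}" by auto
  then show ?thesis unfolding bbd_rel_def by auto
qed

lemma BBD3_swap: "BBD3 n X g1 g2 B \<Longrightarrow> BBD3 n X g2 g1 B"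
  unfolding BBD3_def Un_commute[of g2] Int_commute[of g2] by (elim conjE, intro conjI) auto

lemma BBD3_biquad:
  assumes B: "BBD3 n X g1 g2 B"
  shows "biquad g1 g2 (bbd_rel g1 g2 B)"
  unfolding biquad_def
proof (intro conjI allI impI)
  fix a a' b assume h: "{a,a'} \<subseteq> g1 \<and> b \<in> g2 \<and> a \<noteq> a'"
  show "\<exists>!b'. bbd_rel g1 g2 B a a' b b'" by (rule bbd_rel_ex1[OF B]) (use h in auto)
next
  fix a b b' assume h: "a \<in> g1 \<and> {b,b'} \<subseteq> g2 \<and> b \<noteq> b'"
  show "\<exists>!a'. bbd_rel g1 g2 B a a' b b'"
    unfolding bbd_rel_swap[of g1 g2] by (rule bbd_rel_ex1[OF BBD3_swap[OF B]]) (use h in auto)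
qed (auto simp: bbd_rel_def insert_commute)

text \<open>The bounds by \<open>A'\<close> and \<open>B'\<close> belong to the new relation because
  \<open>f\<close> and \<open>g\<close> may take values in \<open>A\<close> and \<open>B\<close>
  outside these sets as well, which would destroy uniqueness.\<close>

lemma biquad_vimage:
  assumes S: "biquad A B S" and f: "bij_betw f A' A" and g: "bij_betw g B' B"
  shows "biquad A' B' (\<lambda>a a' b b'. {a,a'} \<subseteq> A' \<and> {b,b'} \<subseteq> B' \<and> S (f a) (f a') (g b) (g b'))"
  unfolding biquad_def
proof (intro conjI allI impI)
  have fA: "f x \<in> A" if "x \<in> A'" for x using f that by (auto simp: bij_betw_def)
  have gB: "g x \<in> B" if "x \<in> B'" for x using g that by (auto simp: bij_betw_def)
  have finj: "f x = f y \<longleftrightarrow> x = y" if "x \<in> A'" "y \<in> A'" for x y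
    using f that by (auto simp: bij_betw_def inj_on_eq_iff)
  have ginj: "g x = g y \<longleftrightarrow> x = y" if "x \<in> B'" "y \<in> B'" for x y
    using g that by (auto simp: bij_betw_def inj_on_eq_iff)
  {
    fix a a' b assume h: "{a,a'} \<subseteq> A' \<and> b \<in> B' \<and> a \<noteq> a'"
    then have "\<exists>!y. S (f a) (f a') (g b) y"
      using biquadD(2)[OF S, of "f a" "f a'" "g b"] fA gB finj by simp
    then obtain y where y: "S (f a) (f a') (g b) y" "\<And>z. S (f a) (f a') (g b) z \<Longrightarrow> z = y" by blast
    have "y \<in> B" using biquadD(1)[OF S y(1)] by simp
    then obtain b' where b': "b' \<in> B'" "y = g b'" using g by (auto simp: bij_betw_def)
    show "\<exists>!b'. {a,a'} \<subseteq> A' \<and> {b,b'} \<subseteq> B' \<and> S (f a) (f a') (g b) (g b')"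
    proof (rule ex1I)
      show "{a,a'} \<subseteq> A' \<and> {b,b'} \<subseteq> B' \<and> S (f a) (f a') (g b) (g b')" using h y(1) b' by simp
      fix b'' assume "{a,a'} \<subseteq> A' \<and> {b,b''} \<subseteq> B' \<and> S (f a) (f a') (g b) (g b'')"
      then show "b'' = b'" using y(2) b' ginj by auto
    qed
  }
  {
    fix a b b' assume h: "a \<in> A' \<and> {b,b'} \<subseteq> B' \<and> b \<noteq> b'"
    then have "\<exists>!y. S (f a) y (g b) (g b')"
      using biquadD(3)[OF S, of "f a" "g b" "g b'"] fA gB ginj by simp
    then obtain y where y: "S (f a) y (g b) (g b')" "\<And>z. S (f a) z (g b) (g b') \<Longrightarrow> z = y" by blast
    have "y \<in> A" using biquadD(1)[OF S y(1)] by simp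
    then obtain a' where a': "a' \<in> A'" "y = f a'" using f by (auto simp: bij_betw_def)
    show "\<exists>!a'. {a,a'} \<subseteq> A' \<and> {b,b'} \<subseteq> B' \<and> S (f a) (f a') (g b) (g b')"
    proof (rule ex1I)
      show "{a,a'} \<subseteq> A' \<and> {b,b'} \<subseteq> B' \<and> S (f a) (f a') (g b) (g b')" using h y(1) a' by simp
      fix a'' assume "{a,a''} \<subseteq> A' \<and> {b,b'} \<subseteq> B' \<and> S (f a) (f a'') (g b) (g b')"
      then show "a'' = a'" using y(2) a' finj by auto
    qed
  }
next
  fix a a' b b' assume h: "{a,a'} \<subseteq> A' \<and> {b,b'} \<subseteq> B' \<and> S (f a) (f a') (g b) (g b')"
  then have S': "S (f a) (f a') (g b) (g b')" by simp
  show "{a,a'} \<subseteq> A'" "{b,b'} \<subseteq> B'" using h by simp_all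
  show "a \<noteq> a'" "b \<noteq> b'" using biquadD(1)[OF S S'] by auto
  show "{a',a} \<subseteq> A'" "{b,b'} \<subseteq> B'" "S (f a') (f a) (g b) (g b')"
    "{a,a'} \<subseteq> A'" "{b',b} \<subseteq> B'" "S (f a) (f a') (g b') (g b)"
    using h biquadD(1)[OF S S'] by simp_all
qed

section \<open>Multiplying both parts by four\<close>

definition bdiff :: "bool \<times> bool \<Rightarrow> bool \<times> bool \<Rightarrow> bool \<times> bool" where
  "bdiff k l = (fst k \<noteq> fst l, snd k \<noteq> snd l)"

lemma bdiff_commute: "bdiff k l = bdiff l k"
  by (auto simp: bdiff_def)

lemma bdiff_ex1: "\<exists>!l'. bdiff l l' = d"
  by (rule ex1I[of _ "bdiff l d"]) (cases l; cases d; auto simp: bdiff_def)+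

text \<open>Equal differences in \<open>\<int>\<^sub>2 \<times> \<int>\<^sub>2\<close> vanish
  together, so the two pairs of a block either both stay in one copy or both change copies.\<close>

lemma bdiff_eq_iff: "bdiff k k' = bdiff l l' \<Longrightarrow> k = k' \<longleftrightarrow> l = l'"
  by (cases k; cases k'; cases l; cases l'; auto simp: bdiff_def)

text \<open>\<open>f\<close> hits every residue modulo \<open>m\<close> exactly once, so the point
  with value \<open>(- s) mod m\<close> is the only solution.\<close>

lemma ex1_sum_dvd:
  fixes m s :: int
  assumes f: "bij_betw f A {0..<m}" and "m > 0"
  shows "\<exists>!x. x \<in> A \<and> m dvd s + f x"
proof -
  have "(- s) mod m \<in> {0..<m}" using \<open>m > 0\<close> by simp
  then have "(- s) mod m \<in> f ` A" using f by (simp add: bij_betw_def)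
  then obtain x where x: "x \<in> A" "f x = (- s) mod m" by force
  show ?thesis
  proof (rule ex1I)
    show "x \<in> A \<and> m dvd s + f x" using x by (simp add: mod_add_right_eq mod_eq_0_iff_dvd[symmetric])
    fix y assume y: "y \<in> A \<and> m dvd s + f y"
    have "f y mod m = (- s) mod m"
      using y by (metis add.commute diff_minus_eq_add mod_eq_dvd_iff)
    moreover have "f y \<in> {0..<m}" using y f by (auto simp: bij_betw_def)
    ultimately have "f y = f x" using x by simp
    then show "y = x" using inj_onD[OF bij_betw_imp_inj_on[OF f]] x(1) y by blast
  qed
qed

text \<open>
  Two points in the same copy are joined as in \<open>S\<close>; across copies any Latin condition
  works, here that the four coordinates sum to zero modulo \<open>m\<close>.
\<close>

definition quadruple_rel where
  "quadruple_rel A B S m e f x x' y y' \<longleftrightarrow>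
     {snd x, snd x'} \<subseteq> A \<and> {snd y, snd y'} \<subseteq> B \<and> bdiff (fst x) (fst x') = bdiff (fst y) (fst y') \<and>
     (if fst x = fst x' then S (snd x) (snd x') (snd y) (snd y')
      else m dvd e (snd x) + e (snd x') + f (snd y) + f (snd y'))"

text \<open>The difference condition fixes the copy of the fourth point. Its coordinate is then
  fixed by \<open>S\<close> if the complete pair lies in one copy, and by the congruence
  otherwise.\<close>

lemma biquad_quadruple:
  fixes m :: int
  assumes S: "biquad A B S" and e: "bij_betw e A {0..<m}" and f: "bij_betw f B {0..<m}" and m: "m > 0"
  shows "biquad (UNIV \<times> A) (UNIV \<times> B) (quadruple_rel A B S m e f)" (is "biquad _ _ ?Q")
  unfolding biquad_def
proof (intro conjI allI impI)
  fix x x' :: "(bool \<times> bool) \<times> 'a" and y :: "(bool \<times> bool) \<times> 'b"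
  assume h: "{x,x'} \<subseteq> UNIV \<times> A \<and> y \<in> UNIV \<times> B \<and> x \<noteq> x'"
  obtain l where l: "bdiff (fst y) l = bdiff (fst x) (fst x')"
    "\<And>l'. bdiff (fst y) l' = bdiff (fst x) (fst x') \<Longrightarrow> l' = l" using bdiff_ex1 by metis
  define P where "P b \<longleftrightarrow> b \<in> B \<and> (if fst x = fst x' then S (snd x) (snd x') (snd y) b
      else m dvd e (snd x) + e (snd x') + f (snd y) + f b)" for b
  have "\<exists>!b. P b"
  proof (cases "fst x = fst x'")
    case True
    then have "snd x \<noteq> snd x'" using h by (metis prod_eqI)
    then have "\<exists>!b. S (snd x) (snd x') (snd y) b" using biquadD(2)[OF S, of "snd x" "snd x'" "snd y"] h by auto
    moreover have "b \<in> B \<and> S (snd x) (snd x') (snd y) b \<longleftrightarrow> S (snd x) (snd x') (snd y) b" for b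
      using biquadD(1)[OF S, of "snd x" "snd x'" "snd y" b] by blast
    ultimately show ?thesis using True by (simp add: P_def)
  next
    case False
    then show ?thesis using ex1_sum_dvd[OF f m] by (simp add: P_def)
  qed
  then obtain b where b: "P b" "\<And>c. P c \<Longrightarrow> c = b" by blast
  show "\<exists>!y'. ?Q x x' y y'"
  proof (rule ex1I)
    show "?Q x x' y (l, b)" using h l(1) b(1) unfolding quadruple_rel_def P_def by auto
    fix y' assume q: "?Q x x' y y'"
    then have "fst y' = l" using l(2) unfolding quadruple_rel_def by simp
    moreover have "snd y' = b" using b(2)[of "snd y'"] q unfolding quadruple_rel_def P_def by simp
    ultimately show "y' = (l, b)" by auto
  qed
next
  fix x :: "(bool \<times> bool) \<times> 'a" and y y' :: "(bool \<times> bool) \<times> 'b"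
  assume h: "x \<in> UNIV \<times> A \<and> {y,y'} \<subseteq> UNIV \<times> B \<and> y \<noteq> y'"
  obtain k where k: "bdiff (fst x) k = bdiff (fst y) (fst y')"
    "\<And>k'. bdiff (fst x) k' = bdiff (fst y) (fst y') \<Longrightarrow> k' = k" using bdiff_ex1 by metis
  \<comment> \<open>\<open>quadruple_rel\<close> tests the pair of \<open>x\<close>, but here the
    complete pair is that of \<open>y\<close>; equal differences make the two tests agree.\<close>
  have kiff: "fst x = k \<longleftrightarrow> fst y = fst y'" using bdiff_eq_iff[OF k(1)] .
  define P where "P a \<longleftrightarrow> a \<in> A \<and> (if fst y = fst y' then S (snd x) a (snd y) (snd y')
      else m dvd e (snd x) + e a + f (snd y) + f (snd y'))" for a
  have "\<exists>!a. P a"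
  proof (cases "fst y = fst y'")
    case True
    then have "snd y \<noteq> snd y'" using h by (metis prod_eqI)
    then have "\<exists>!a. S (snd x) a (snd y) (snd y')" using biquadD(3)[OF S, of "snd x" "snd y" "snd y'"] h by auto
    moreover have "a \<in> A \<and> S (snd x) a (snd y) (snd y') \<longleftrightarrow> S (snd x) a (snd y) (snd y')" for a
      using biquadD(1)[OF S, of "snd x" a "snd y" "snd y'"] by blast
    ultimately show ?thesis using True by (simp add: P_def)
  next
    case False
    then show ?thesis
      using ex1_sum_dvd[OF e m, of "e (snd x) + f (snd y) + f (snd y')"] by (simp add: P_def ac_simps)
  qed
  then obtain a where a: "P a" "\<And>c. P c \<Longrightarrow> c = a" by blast
  show "\<exists>!x'. ?Q x x' y y'"
  proof (rule ex1I)
    show "?Q x (k, a) y y'" using h k(1) a(1) kiff unfolding quadruple_rel_def P_def by auto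
    fix x' assume q: "?Q x x' y y'"
    then have "fst x' = k" using k(2) unfolding quadruple_rel_def by simp
    moreover have "snd x' = a" using a(2)[of "snd x'"] q kiff calculation
      unfolding quadruple_rel_def P_def by (simp split: if_splits)
    ultimately show "x' = (k, a)" by auto
  qed
next
  fix x x' :: "(bool \<times> bool) \<times> 'a" and y y' :: "(bool \<times> bool) \<times> 'b"
  assume q: "?Q x x' y y'"
  then have d: "bdiff (fst x) (fst x') = bdiff (fst y) (fst y')" by (simp add: quadruple_rel_def)
  show "{x,x'} \<subseteq> UNIV \<times> A" "{y,y'} \<subseteq> UNIV \<times> B"
    using q by (cases x; cases x'; cases y; cases y'; simp add: quadruple_rel_def)+
  have kl: "fst x = fst x' \<longleftrightarrow> fst y = fst y'" by (rule bdiff_eq_iff[OF d])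
  have sub: "{snd x, snd x'} \<subseteq> A" "{snd y, snd y'} \<subseteq> B" using q by (auto simp: quadruple_rel_def)
  have "x \<noteq> x' \<and> y \<noteq> y' \<and> ?Q x' x y y' \<and> ?Q x x' y' y"
  proof (cases "fst x = fst x'")
    case True
    then have "S (snd x) (snd x') (snd y) (snd y')" using q by (simp add: quadruple_rel_def)
    note biquadD(1)[OF S this]
    then show ?thesis using True kl d sub
      unfolding quadruple_rel_def by (auto simp: bdiff_commute)
  next
    case False
    then have "m dvd e (snd x) + e (snd x') + f (snd y) + f (snd y')"
      using q by (simp add: quadruple_rel_def)
    moreover have "x \<noteq> x'" "y \<noteq> y'" using False kl by auto
    moreover have "fst x' \<noteq> fst x" "fst y' \<noteq> fst y" using False kl by auto
    ultimately show ?thesis using False d sub bdiff_commute[of "fst x'"] bdiff_commute[of "fst y'"]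
      unfolding quadruple_rel_def by (simp add: add.commute add.left_commute)
  qed
  then show "x \<noteq> x'" "y \<noteq> y'" "?Q x' x y y'" "?Q x x' y' y" by blast+
qed

section \<open>The points and the mixed blocks\<close>

datatype pt = Inf bool | Pt bool bool int

lemma dvd_diff_eq:
  fixes a b N :: int
  assumes "N dvd a - b" "a \<in> {0..<N}" "b \<in> {0..<N}"
  shows "a = b"
  using assms by (metis atLeastLessThan_iff mod_eq_dvd_iff mod_pos_pos_trivial)

lemma eq_modI:
  fixes t y N :: int
  assumes "y \<in> {0..<N}" "N dvd y - t"
  shows "y = t mod N"
  using assms by (metis atLeastLessThan_iff mod_eq_dvd_iff mod_pos_pos_trivial)

locale hanani =
  fixes n :: int
  assumes n_pos: "n > 0"
begin

definition "stem = {Inf False, Inf True}"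
definition "grp h i = Pt h i ` {0..<2*n}"
definition "points = stem \<union> (\<Union>h. \<Union>i. grp h i)"

definition "twist h = (if h then - 1 else 1 :: int)"

text \<open>A half of the residues that contains exactly one of \<open>t\<close> and
  \<open>t + n\<close>, and exactly one of \<open>t\<close> and \<open>- t - 1\<close>. The first
  property separates the two degenerate blocks on a pair \<open>x\<close>, \<open>y\<close>, the
  second makes the labels of both halves opposite.\<close>

definition "low t \<longleftrightarrow> t mod (2*n) < n"

text \<open>
  The index of the point at infinity on a block through \<open>u\<close> in group \<open>(h, i)\<close> and \<open>z\<close> in group
  \<open>(\<not>h, j)\<close>. It depends on a single pair, so it has to agree for both points \<open>u\<close> of the block. The
  blocks for \<open>h\<close> and for \<open>\<not>h\<close> meet the same pairs, so their labels have to be opposite. Both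
  conditions force the signs and shifts here and the choice of \<open>twist\<close>.
\<close>

definition "label h i j u z \<longleftrightarrow>
  low ((if i = j then z - u + of_bool i * twist h else u - z) - of_bool h)"

definition "inc h x y j z w \<longleftrightarrow> {x,y,z,w} \<subseteq> {0..<2*n} \<and>
  2*n dvd z + w + of_bool j * twist h - x - y"

text \<open>The label is computed from \<open>x\<close>; on a block with \<open>w = z\<close> the
  point \<open>y\<close> yields the same one, by \<open>label_block\<close>.\<close>

definition "mixed_block h x y j z w =
  {Pt h False x, Pt h True y, Pt (\<not>h) j z,
   if w = z then Inf (label h False j x z) else Pt (\<not>h) j w}"

definition "mixed_blocks h = {mixed_block h x y j z w | x y j z w. inc h x y j z w}"

text \<open>For a pair of points with different first bits, rule \<open>luz\<close> takes one of the
  two triples with a point at infinity; the other one belongs to the family of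
  \<open>\<not>h\<close>. In \<open>xyz\<close> the two points with equal first bit lie in different
  groups, in \<open>uzw\<close> in the same group, which separates the two families here
  too.\<close>

inductive_set mixed_triples :: "bool \<Rightarrow> pt set set" for h where
  xyz: "{x,y,z} \<subseteq> {0..<2*n} \<Longrightarrow> {Pt h False x, Pt h True y, Pt (\<not>h) j z} \<in> mixed_triples h"
| uzw: "{u,z,w} \<subseteq> {0..<2*n} \<Longrightarrow> z \<noteq> w \<Longrightarrow>
    {Pt h i u, Pt (\<not>h) j z, Pt (\<not>h) j w} \<in> mixed_triples h"
| lxy: "{x,y} \<subseteq> {0..<2*n} \<Longrightarrow> {Inf l, Pt h False x, Pt h True y} \<in> mixed_triples h"
| luz: "{u,z} \<subseteq> {0..<2*n} \<Longrightarrow> {Inf (label h i j u z), Pt h i u, Pt (\<not>h) j z} \<in> mixed_triples h"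

section \<open>Symmetries of the labels\<close>

lemma low_cong: "2*n dvd s - t \<Longrightarrow> low s = low t"
  unfolding low_def by (metis mod_eq_dvd_iff)

lemma low_add: "low (t + n) \<longleftrightarrow> \<not> low t"
proof -
  let ?r = "t mod (2*n)"
  have r: "0 \<le> ?r" "?r < 2*n" using n_pos by auto
  have "(t + n) mod (2*n) = (?r + n) mod (2*n)" by (simp add: mod_add_left_eq)
  also have "\<dots> = (if ?r < n then ?r + n else ?r - n)"
    using r by (auto intro!: int_mod_pos_eq[where q = 0] int_mod_pos_eq[where q = 1])
  finally show ?thesis unfolding low_def using r by auto
qed

text \<open>The residue \<open>r\<close> goes to \<open>2*n - 1 - r\<close>, which exchanges the
  halves. The extra \<open>- 1\<close> matters: plain negation fixes the residues \<open>0\<close>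
  and \<open>n\<close>.\<close>

lemma low_minus: "low (- t - 1) \<longleftrightarrow> \<not> low t"
proof -
  let ?r = "t mod (2*n)"
  have r: "0 \<le> ?r" "?r < 2*n" using n_pos by auto
  have "t = 2*n * (t div (2*n)) + ?r" by simp
  then have "- t - 1 = 2*n * (- (t div (2*n)) - 1) + (2*n - 1 - ?r)" by (simp add: algebra_simps)
  then have "(- t - 1) mod (2*n) = 2*n - 1 - ?r"
    using r by (intro int_mod_pos_eq) auto
  then show ?thesis unfolding low_def using r by auto
qed

text \<open>Exchanging the points turns the argument \<open>t\<close> of \<open>low\<close> into
  \<open>- t - 1\<close>: differences and \<open>twist\<close> change sign, and
  \<open>of_bool h\<close> and \<open>of_bool (\<not>h)\<close> add up to 1.\<close>

lemma label_opposite: "label (\<not>h) j i z u \<longleftrightarrow> \<not> label h i j u z"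
proof -
  have *: "low s \<longleftrightarrow> \<not> low t" if "s = - t - 1" for s t using that low_minus by simp
  show ?thesis unfolding label_def
    by (rule *) (cases h; cases i; cases j; simp add: twist_def)
qed

text \<open>The argument of \<open>low\<close> moves by \<open>n\<close> or by \<open>- n\<close>,
  which agree modulo \<open>2*n\<close>, so \<open>low_add\<close> applies.\<close>

lemma label_shift:
  assumes "2*n dvd z - w - n"
  shows "label h i j u z \<longleftrightarrow> \<not> label h i j u w"
proof -
  have *: "low s \<longleftrightarrow> \<not> low t" if "2*n dvd s - t - n" for s t
    using low_cong[of s "t + n"] low_add[of t] that by (simp add: diff_diff_eq)
  have "2*n dvd w - z - n"
    using assms dvd_diff[of "2*n" "- 2*n" "z - w - n"] by (simp add: algebra_simps)
  then show ?thesis unfolding label_def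
    by (intro *) (use assms in \<open>auto simp: algebra_simps\<close>)
qed

text \<open>Up to sign the two arguments of \<open>low\<close> differ by
  \<open>z + z + of_bool j * twist h - x - y\<close>, which \<open>inc\<close> makes divisible by
  \<open>2*n\<close>.\<close>

lemma label_block:
  assumes "inc h x y j z z"
  shows "label h True j y z = label h False j x z"
  using assms unfolding label_def inc_def
  by (cases j) (auto intro!: low_cong simp: algebra_simps dvd_diff_commute)

lemma mod_mem: "t mod (2*n) \<in> {0..<2*n}"
  using n_pos by simp

lemma dvd_mod: "2*n dvd t mod (2*n) - t"
  by (simp add: mod_eq_dvd_iff[symmetric])

section \<open>Solving the congruence of the mixed blocks\<close>

lemma inc_sym: "inc h x y j z w \<Longrightarrow> inc h x y j w z"
  unfolding inc_def by (simp add: algebra_simps)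

text \<open>All four coordinates enter the congruence with coefficient 1 or -1, so any three of them
  determine the last as a residue. The same holds for \<open>inc_unique_y\<close> and
  \<open>inc_unique_x\<close>.\<close>

lemma inc_unique_w:
  assumes "{x,y,z} \<subseteq> {0..<2*n}" shows "\<exists>!w. inc h x y j z w"
proof (rule ex1I)
  let ?t = "x + y - z - of_bool j * twist h"
  show "inc h x y j z (?t mod (2*n))"
    unfolding inc_def using assms mod_mem dvd_mod[of ?t] by (simp add: algebra_simps)
  then show "w = ?t mod (2*n)" if "inc h x y j z w" for w
    using that unfolding inc_def by (intro eq_modI) (simp_all add: algebra_simps)
qed


lemma inc_unique_y:
  assumes "{x,z,w} \<subseteq> {0..<2*n}" shows "\<exists>!y. inc h x y j z w"
proof (rule ex1I)
  let ?t = "z + w + of_bool j * twist h - x"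
  show "inc h x (?t mod (2*n)) j z w"
    unfolding inc_def using assms mod_mem dvd_mod[of ?t]
    by (simp add: algebra_simps dvd_diff_commute)
  then show "y = ?t mod (2*n)" if "inc h x y j z w" for y
    using that unfolding inc_def
    by (intro eq_modI) (simp_all add: algebra_simps dvd_diff_commute)
qed

lemma inc_swap: "inc h x y j z w \<longleftrightarrow> inc h y x j z w"
  unfolding inc_def by (auto simp: algebra_simps)

lemma inc_unique_x:
  assumes "{y,z,w} \<subseteq> {0..<2*n}" shows "\<exists>!x. inc h x y j z w"
  using inc_unique_y[of y z w h j] assms inc_swap by simp

lemma odd_twist: "odd (twist h)"
  by (simp add: twist_def)

text \<open>Setting \<open>z = w\<close> gives a congruence for \<open>2 * z\<close> modulo
  \<open>2*n\<close>. It is solvable for one parity of \<open>j\<close> only, and then has two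
  solutions at distance \<open>n\<close>; their labels are opposite, so exactly one has label
  \<open>l\<close>.\<close>

lemma inc_unique_label:
  assumes xy: "{x,y} \<subseteq> {0..<2*n}"
  obtains j z where "inc h x y j z z" "label h False j x z = l"
    "\<And>j' z'. inc h x y j' z' z' \<Longrightarrow> label h False j' x z' = l \<Longrightarrow> j' = j \<and> z' = z"
proof -
  \<comment> \<open>Since \<open>twist h\<close> is odd, this choice makes the right-hand side of
    the congruence for \<open>2 * z\<close> even.\<close>
  define j where "j = odd (x + y)"
  have "even (x + y - of_bool j * twist h)" using odd_twist by (simp add: j_def)
  then obtain t where t: "x + y - of_bool j * twist h = 2 * t" by blast
  \<comment> \<open>Halving leaves \<open>z\<close> congruent to \<open>t\<close> modulo
    \<open>n\<close>, which has these two solutions among the residues modulo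
    \<open>2*n\<close>.\<close>
  let ?z0 = "t mod (2*n)" and ?z1 = "(t + n) mod (2*n)"
  have inc_iff: "inc h x y j z z \<longleftrightarrow> z \<in> {0..<2*n} \<and> n dvd z - t" for z
  proof -
    have e: "z + z + of_bool j * twist h - x - y = 2 * (z - t)" using t by (simp add: algebra_simps)
    have "2*n dvd 2 * (z - t) \<longleftrightarrow> n dvd z - t" by (simp only: dvd_mult_cancel_left) simp
    then show ?thesis unfolding inc_def e using xy by auto
  qed
  have d0: "2*n dvd ?z0 - t" and d1: "2*n dvd ?z1 - (t + n)" by (rule dvd_mod)+
  have "n dvd ?z0 - t" using d0 dvd_mult_right by blast
  then have i0: "inc h x y j ?z0 ?z0" using inc_iff mod_mem by simp
  have "n dvd ?z1 - (t + n)" using d1 dvd_mult_right by blast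
  then have "n dvd ?z1 - (t + n) + n" by (rule dvd_add) simp
  then have i1: "inc h x y j ?z1 ?z1" using inc_iff mod_mem by simp
  have "2*n dvd ?z1 - ?z0 - n" using dvd_diff[OF d1 d0] by (simp add: algebra_simps)
  then have opp: "label h False j x ?z1 \<longleftrightarrow> \<not> label h False j x ?z0" by (rule label_shift)
  \<comment> \<open>The modulus is even, so the congruence may be read modulo 2, where it determines
    \<open>j'\<close>.\<close>
  have j: "j' = j" if "inc h x y j' z z" for j' z
  proof -
    have "2 dvd z + z + of_bool j' * twist h - x - y"
      using that unfolding inc_def by (metis dvd_mult_left)
    then show ?thesis using odd_twist by (cases j') (auto simp: j_def)
  qed
  have two: "z = ?z0 \<or> z = ?z1" if "inc h x y j z z" for z
  proof -
    have z: "z \<in> {0..<2*n}" "n dvd z - t" using that inc_iff by auto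
    then obtain k where k: "z - t = n * k" by (elim dvdE)
    show ?thesis
    proof (cases "even k")
      case True
      then have "2*n dvd z - t" using k by auto
      then have "2*n dvd z - ?z0" using dvd_diff[OF _ d0] by fastforce
      then show ?thesis using dvd_diff_eq z mod_mem by blast
    next
      case False
      then obtain q where "k = 2*q + 1" by (rule oddE)
      then have "2*n dvd z - (t + n)" using k by (simp add: algebra_simps)
      then have "2*n dvd z - ?z1" using dvd_diff[OF _ d1] by fastforce
      then show ?thesis using dvd_diff_eq z mod_mem by blast
    qed
  qed
  show thesis
  proof (cases "label h False j x ?z0 = l")
    case True
    show thesis
    proof (rule that[OF i0])
      show "label h False j x ?z0 = l" using True by blast
      fix j' z' assume a: "inc h x y j' z' z'" "label h False j' x z' = l"
      have "j' = j" using j a(1) .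
      then show "j' = j \<and> z' = ?z0" using two[of z'] a opp True by auto
    qed
  next
    case False
    show thesis
    proof (rule that[OF i1])
      show "label h False j x ?z1 = l" using False opp by blast
      fix j' z' assume a: "inc h x y j' z' z'" "label h False j' x z' = l"
      have "j' = j" using j a(1) .
      then show "j' = j \<and> z' = ?z1" using two[of z'] a opp False opp by auto
    qed
  qed
qed

section \<open>Mixed blocks cover mixed triples\<close>

lemma mixed_block_sym: "mixed_block h x y j z w = mixed_block h x y j w z"
  unfolding mixed_block_def by auto

text \<open>This and the next three equivalences read off the parameters of a block from a triple in
  it, so that uniqueness of the block becomes uniqueness of a solution of
  \<open>inc\<close>.\<close>

lemma subset_mixed_block_xyz:
  "{Pt h False x, Pt h True y, Pt (\<not>h) j z} \<subseteq> mixed_block h x' y' j' z' w' \<longleftrightarrow>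
   x' = x \<and> y' = y \<and> j' = j \<and> (z' = z \<or> w' = z)"
  unfolding mixed_block_def by auto

lemma subset_mixed_block_uzw:
  "z \<noteq> w \<Longrightarrow> {Pt h i u, Pt (\<not>h) j z, Pt (\<not>h) j w} \<subseteq> mixed_block h x' y' j' z' w' \<longleftrightarrow>
   (if i then y' = u else x' = u) \<and> j' = j \<and> (z' = z \<and> w' = w \<or> z' = w \<and> w' = z)"
  unfolding mixed_block_def by auto

lemma subset_mixed_block_lxy:
  "{Inf l, Pt h False x, Pt h True y} \<subseteq> mixed_block h x' y' j' z' w' \<longleftrightarrow>
   x' = x \<and> y' = y \<and> w' = z' \<and> label h False j' x z' = l"
  unfolding mixed_block_def by auto

lemma subset_mixed_block_luz:
  "{Inf l, Pt h i u, Pt (\<not>h) j z} \<subseteq> mixed_block h x' y' j' z' w' \<longleftrightarrow>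
   (if i then y' = u else x' = u) \<and> j' = j \<and> z' = z \<and> w' = z \<and> label h False j x' z = l"
  unfolding mixed_block_def by auto

text \<open>Each shape of triple leaves one unknown in \<open>inc\<close>, solved by the matching
  uniqueness lemma; only \<open>lxy\<close> leaves both \<open>j\<close> and \<open>z\<close> open
  and needs the label as well.\<close>

lemma covers_mixed: "covers (mixed_blocks h) (mixed_triples h)"
  unfolding covers_def
proof (intro conjI ballI allI impI)
  fix b T assume "b \<in> mixed_blocks h" and T: "T \<subseteq> b \<and> card T = 3"
  then obtain x y j z w where i: "inc h x y j z w" and b: "b = mixed_block h x y j z w"
    unfolding mixed_blocks_def by blast
  have Z: "{x,y,z,w} \<subseteq> {0..<2*n}" using i by (simp add: inc_def)
  show "T \<in> mixed_triples h"
  proof (cases "w = z")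
    case True
    let ?l = "label h False j x z"
    \<comment> \<open>Needed for the triple of \<open>Inf ?l\<close>, \<open>y\<close> and
      \<open>z\<close>, since rule \<open>luz\<close> takes its label from \<open>y\<close>.\<close>
    have "label h True j y z = ?l" using i True label_block by simp
    moreover have "T = {Pt h False x, Pt h True y, Pt (\<not>h) j z} \<or> T = {Inf ?l, Pt h False x, Pt h True y} \<or>
        T = {Inf ?l, Pt h False x, Pt (\<not>h) j z} \<or> T = {Inf ?l, Pt h True y, Pt (\<not>h) j z}"
      using card_3_subset_4[of T "Inf ?l" "Pt h False x" "Pt h True y" "Pt (\<not>h) j z"] T
      unfolding b mixed_block_def True by (auto simp: insert_commute)
    ultimately show ?thesis
      using Z mixed_triples.xyz[of x y z h j] mixed_triples.lxy[of x y ?l h]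
        mixed_triples.luz[of x z h False j] mixed_triples.luz[of y z h True j] by auto
  next
    case False
    have "T = {Pt h False x, Pt h True y, Pt (\<not>h) j z} \<or> T = {Pt h False x, Pt h True y, Pt (\<not>h) j w} \<or>
        T = {Pt h False x, Pt (\<not>h) j z, Pt (\<not>h) j w} \<or> T = {Pt h True y, Pt (\<not>h) j z, Pt (\<not>h) j w}"
      using card_3_subset_4[of T "Pt h False x" "Pt h True y" "Pt (\<not>h) j z" "Pt (\<not>h) j w"] T False
      unfolding b mixed_block_def by simp
    then show ?thesis
      using Z False mixed_triples.xyz[of x y z h j] mixed_triples.xyz[of x y w h j]
        mixed_triples.uzw[of x z w h False j] mixed_triples.uzw[of y z w h True j] by auto
  qed
next
  fix T assume T: "T \<in> mixed_triples h"
  then show "card T = 3" by (cases rule: mixed_triples.cases) auto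
  \<comment> \<open>Parameters are unique only up to exchanging \<open>z\<close> and
    \<open>w\<close>, which leaves the block unchanged.\<close>
  have ex1: "\<exists>!b. b \<in> mixed_blocks h \<and> T \<subseteq> b"
    if "inc h x y j z w" "T \<subseteq> mixed_block h x y j z w"
      and uniq: "\<And>x' y' j' z' w'. \<lbrakk>inc h x' y' j' z' w'; T \<subseteq> mixed_block h x' y' j' z' w'\<rbrakk> \<Longrightarrow>
        x' = x \<and> y' = y \<and> j' = j \<and> (z' = z \<and> w' = w \<or> z' = w \<and> w' = z)" for x y j z w
  proof (rule ex1I[of _ "mixed_block h x y j z w"])
    show "mixed_block h x y j z w \<in> mixed_blocks h \<and> T \<subseteq> mixed_block h x y j z w"
      using that(1,2) unfolding mixed_blocks_def by blast
    show "b = mixed_block h x y j z w" if mem: "b \<in> mixed_blocks h \<and> T \<subseteq> b" for b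
    proof -
      obtain x' y' j' z' w' where b: "b = mixed_block h x' y' j' z' w'" "inc h x' y' j' z' w'"
        using mem unfolding mixed_blocks_def by blast
      then have "x' = x \<and> y' = y \<and> j' = j \<and> (z' = z \<and> w' = w \<or> z' = w \<and> w' = z)"
        using uniq[OF b(2)] mem by simp
      then show ?thesis using b(1) mixed_block_sym[of h x y j z w] by (elim conjE disjE) simp_all
    qed
  qed
  from T show "\<exists>!b. b \<in> mixed_blocks h \<and> T \<subseteq> b"
  proof (cases rule: mixed_triples.cases)
    case (xyz x y z j)
    note sub = subset_mixed_block_xyz[of h x y j z, folded xyz(1)]
    obtain w where w: "inc h x y j z w" "\<And>w'. inc h x y j z w' \<Longrightarrow> w' = w"
      using inc_unique_w[OF xyz(2)] by blast
    show ?thesis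
      by (rule ex1[OF w(1)]; unfold sub) (use w(2) inc_sym in blast)+
  next
    case (uzw u z w i j)
    note sub = subset_mixed_block_uzw[OF uzw(3), of h i u j, folded uzw(1)]
    show ?thesis
    proof (cases i)
      case False
      obtain y where y: "inc h u y j z w" "\<And>y'. inc h u y' j z w \<Longrightarrow> y' = y"
        using inc_unique_y[OF uzw(2)] by blast
      show ?thesis
        by (rule ex1[OF y(1)]; unfold sub if_not_P[OF False]) (use y(2) inc_sym in blast)+
    next
      case True
      obtain x where x: "inc h x u j z w" "\<And>x'. inc h x' u j z w \<Longrightarrow> x' = x"
        using inc_unique_x[OF uzw(2)] by blast
      show ?thesis
        by (rule ex1[OF x(1)]; unfold sub if_P[OF True]) (use x(2) inc_sym in blast)+
    qed
  next
    case (lxy x y l)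
    note sub = subset_mixed_block_lxy[of l h x y, folded lxy(1)]
    obtain j z where jz: "inc h x y j z z" "label h False j x z = l"
      "\<And>j' z'. inc h x y j' z' z' \<Longrightarrow> label h False j' x z' = l \<Longrightarrow> j' = j \<and> z' = z"
      by (rule inc_unique_label[OF lxy(2), where h = h and l = l]) metis
    show ?thesis
      by (rule ex1[OF jz(1)]; unfold sub) (use jz(2,3) in metis)+
  next
    case (luz u z i j)
    note sub = subset_mixed_block_luz[of "label h i j u z" h i u j z, folded luz(1)]
    \<comment> \<open>A mixed block with a point at infinity has \<open>w = z\<close>, so the
      congruence is solved with \<open>z\<close> taken twice.\<close>
    have uz: "{u,z,z} \<subseteq> {0..<2*n}" using luz(2) by simp
    show ?thesis
    proof (cases i)
      case False
      obtain y where y: "inc h u y j z z" "\<And>y'. inc h u y' j z z \<Longrightarrow> y' = y"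
        using inc_unique_y[OF uz] by blast
      have "label h False j u z = label h i j u z" using False by simp
      then show ?thesis
        by (intro ex1[OF y(1)]; unfold sub if_not_P[OF False]) (use y(2) in blast)+
    next
      case True
      obtain x where x: "inc h x u j z z" "\<And>x'. inc h x' u j z z \<Longrightarrow> x' = x"
        using inc_unique_x[OF uz] by blast
      have "label h False j x z = label h i j u z" using True label_block[OF x(1)] by simp
      then show ?thesis
        by (intro ex1[OF x(1)]; unfold sub if_P[OF True]) (use x(2) in blast)+
    qed
  qed
qed

section \<open>Classification of all triples of points\<close>

definition "group_triples h i = {T. T \<subseteq> stem \<union> grp h i \<and> card T = 3}"

inductive_set pair_triples :: "bool \<Rightarrow> pt set set" for h where
  "{x,x',y} \<subseteq> {0..<2*n} \<Longrightarrow> x \<noteq> x' \<Longrightarrow> {Pt h i x, Pt h i x', Pt h (\<not>i) y} \<in> pair_triples h"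

lemma Pt_in_grp [simp]: "Pt h i x \<in> grp h' i' \<longleftrightarrow> h = h' \<and> i = i' \<and> x \<in> {0..<2*n}"
  unfolding grp_def by auto

lemma Inf_in_grp [simp]: "Inf l \<notin> grp h i"
  unfolding grp_def by auto

lemma Inf_in_stem [simp]: "Inf l \<in> stem"
  unfolding stem_def by (cases l) auto

lemma Pt_in_stem [simp]: "Pt h i x \<notin> stem"
  unfolding stem_def by auto

text \<open>Two different groups share only the points at infinity, of which there are two, too few
  for a triple.\<close>

lemma group_triples_disjoint:
  assumes "(h, i) \<noteq> (h', i')"
  shows "group_triples h i \<inter> group_triples h' i' = {}"
proof -
  have "card T \<noteq> 3" if "T \<subseteq> stem \<union> grp h i" "T \<subseteq> stem \<union> grp h' i'" for T
  proof -
    have "grp h i \<inter> grp h' i' = {}" using assms unfolding grp_def by auto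
    then have "T \<subseteq> stem" using that by blast
    then have "card T \<le> card stem" by (intro card_mono) (simp_all add: stem_def)
    then show ?thesis by (simp add: stem_def)
  qed
  then show ?thesis unfolding group_triples_def by blast
qed

lemma pair_triples_disjoint:
  assumes "h \<noteq> h'"
  shows "pair_triples h \<inter> pair_triples h' = {}"
  unfolding disjoint_iff
proof (intro allI impI notI)
  fix T assume "T \<in> pair_triples h" and T: "T \<in> pair_triples h'"
  then show False
  proof cases
    case (1 x x' y i)
    then have "Pt h i x \<in> T" by simp
    with T show False by cases (use assms in auto)
  qed
qed

lemma group_pair_disjoint: "group_triples h i \<inter> pair_triples h' = {}"
  unfolding disjoint_iff
proof (intro allI impI notI)
  fix T assume T: "T \<in> group_triples h i" and "T \<in> pair_triples h'"
  from this(2) show False by cases (use T in \<open>auto simp: group_triples_def\<close>)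
qed

lemma group_mixed_disjoint: "group_triples h i \<inter> mixed_triples h' = {}"
  unfolding disjoint_iff
proof (intro allI impI notI)
  fix T assume T: "T \<in> group_triples h i" and "T \<in> mixed_triples h'"
  from this(2) show False by cases (use T in \<open>auto simp: group_triples_def\<close>)
qed

text \<open>A mixed triple has a point at infinity or points with both values of the first bit; a
  pair triple has neither.\<close>

lemma pair_mixed_disjoint: "pair_triples h \<inter> mixed_triples h' = {}"
  unfolding disjoint_iff
proof (intro allI impI notI)
  fix T assume T: "T \<in> pair_triples h" and "T \<in> mixed_triples h'"
  have *: "\<exists>i x. p = Pt h i x" if "p \<in> T" for p
    using T that by cases auto
  from \<open>T \<in> mixed_triples h'\<close> show False
  proof cases
    case (xyz x y z j)
    then show False using *[of "Pt h' False x"] *[of "Pt (\<not>h') j z"] by auto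
  next
    case (uzw u z w i j)
    then show False using *[of "Pt h' i u"] *[of "Pt (\<not>h') j z"] by auto
  next
    case (lxy x y l)
    then show False using *[of "Inf l"] by auto
  next
    case (luz u z i j)
    then show False using *[of "Inf (label h' i j u z)"] by auto
  qed
qed

text \<open>The number of points at infinity and the groups of the other points separate all shapes
  except \<open>luz\<close> from \<open>luz\<close>. There the labels decide, being opposite by
  \<open>label_opposite\<close>.\<close>

lemma mixed_triples_disjoint:
  assumes "h \<noteq> h'"
  shows "mixed_triples h \<inter> mixed_triples h' = {}"
proof -
  have h': "h' = (\<not> h)" using assms by simp
  have False if "T \<in> mixed_triples h" "T \<in> mixed_triples (\<not> h)" for T
    using that(1)
  proof cases
    case (xyz x y z j)
    then have *: "Pt h False x \<in> T" "Pt h True y \<in> T" "Pt (\<not>h) j z \<in> T" by auto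
    show False using that(2) by cases (use * in auto)
  next
    case (uzw u z w i j)
    then have *: "Pt h i u \<in> T" "Pt (\<not>h) j z \<in> T" "Pt (\<not>h) j w \<in> T" by auto
    show False using that(2) by cases (use * uzw(3) in auto)
  next
    case (lxy x y l)
    then have *: "Inf l \<in> T" "Pt h False x \<in> T" "Pt h True y \<in> T" by auto
    show False using that(2) by cases (use * in auto)
  next
    case (luz u z i j)
    then have *: "Inf (label h i j u z) \<in> T" "Pt h i u \<in> T" "Pt (\<not>h) j z \<in> T" by auto
    from that(2) show False
    proof cases
      case (luz u' z' i' j')
      then have "label (\<not>h) i' j' u' z' = label h i j u z" "u' = z" "z' = u" "i' = j" "j' = i"
        using * by auto
      then show False using label_opposite[of h j i z u] by blast
    qed (use * in auto)
  qed
  then show ?thesis unfolding h' by blast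
qed

definition "all_triples = (\<Union>(h, i)\<in>UNIV. group_triples h i) \<union>
  ((\<Union>h. pair_triples h) \<union> (\<Union>h. mixed_triples h))"

lemma all_triplesI:
  "T \<subseteq> stem \<union> grp h i \<Longrightarrow> card T = 3 \<Longrightarrow> T \<in> all_triples"
  "T \<in> pair_triples h \<Longrightarrow> T \<in> all_triples"
  "T \<in> mixed_triples h \<Longrightarrow> T \<in> all_triples"
  unfolding all_triples_def group_triples_def by auto

text \<open>If the first bits differ, \<open>l\<close> is either the label for \<open>h\<close> or,
  by \<open>label_opposite\<close>, the label for \<open>\<not>h\<close>, so one of the two mixed
  families contains the triple.\<close>

lemma triple_stem:
  assumes "Pt h i u \<in> grp h i" "Pt h' j z \<in> grp h' j" "Pt h i u \<noteq> Pt h' j z"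
  shows "{Inf l, Pt h i u, Pt h' j z} \<in> all_triples"
proof -
  have Z: "{u,z} \<subseteq> {0..<2*n}" using assms by simp
  consider "h' = h" "j = i" | "h' = h" "j = (\<not>i)" | "h' = (\<not>h)" by blast
  then show ?thesis
  proof cases
    case 1
    then show ?thesis using assms by (intro all_triplesI(1)[of _ h i]) auto
  next
    case 2
    then have "{Inf l, Pt h i u, Pt h' j z} =
        (if i then {Inf l, Pt h False z, Pt h True u} else {Inf l, Pt h False u, Pt h True z})"
      by auto
    then show ?thesis
      using mixed_triples.lxy[of z u l h] mixed_triples.lxy[of u z l h] Z
      by (auto intro: all_triplesI(3))
  next
    case 3
    show ?thesis
    proof (cases "label h i j u z = l")
      case True
      then show ?thesis using 3 Z mixed_triples.luz[of u z h i j] by (auto intro: all_triplesI(3))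
    next
      case False
      then have "label (\<not>h) j i z u = l" using label_opposite by auto
      moreover have "{Inf l, Pt (\<not>h) j z, Pt h i u} = {Inf l, Pt h i u, Pt h' j z}" using 3 by auto
      ultimately show ?thesis
        using Z mixed_triples.luz[of z u "\<not>h" j i] by (auto intro: all_triplesI(3))
    qed
  qed
qed

lemma triple_no_stem:
  assumes "{x,y,z} \<subseteq> {0..<2*n}" "card {Pt h i x, Pt h i' y, Pt h' j z} = 3"
  shows "{Pt h i x, Pt h i' y, Pt h' j z} \<in> all_triples" (is "?T \<in> _")
proof -
  have d: "Pt h i x \<noteq> Pt h i' y" "Pt h i x \<noteq> Pt h' j z" "Pt h i' y \<noteq> Pt h' j z"
    using assms(2) by (auto simp: card_insert_if split: if_splits)
  consider "h' = h" "i' = i" "j = i" | "h' = h" "i' = i" "j = (\<not>i)"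
    | "h' = h" "i' = (\<not>i)" "j = i" | "h' = h" "i' = (\<not>i)" "j = i'"
    | "h' = (\<not>h)" "i' = i" | "h' = (\<not>h)" "i' = (\<not>i)" by blast
  then show ?thesis
  proof cases
    case 1
    then show ?thesis using assms by (intro all_triplesI(1)[of _ h i]) auto
  next
    case 2
    then show ?thesis
      using pair_triples.intros[of x y z h i] assms(1) d by (intro all_triplesI(2)[of _ h]) auto
  next
    case 3
    then have "?T = {Pt h i x, Pt h i z, Pt h (\<not>i) y}" by auto
    then show ?thesis
      using 3 pair_triples.intros[of x z y h i] assms(1) d by (intro all_triplesI(2)[of _ h]) auto
  next
    case 4
    then have "?T = {Pt h i' y, Pt h i' z, Pt h (\<not>i') x}" by auto
    then show ?thesis
      using 4 pair_triples.intros[of y z x h i'] assms(1) d by (intro all_triplesI(2)[of _ h]) auto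
  next
    case 5
    then have "?T = {Pt h' j z, Pt (\<not>h') i x, Pt (\<not>h') i y}" by auto
    then show ?thesis
      using 5 mixed_triples.uzw[of z x y h' j i] assms(1) d by (intro all_triplesI(3)[of _ h']) auto
  next
    case 6
    then have "?T = (if i then {Pt h False y, Pt h True x, Pt (\<not>h) j z}
                     else {Pt h False x, Pt h True y, Pt (\<not>h) j z})" by auto
    then show ?thesis
      using mixed_triples.xyz[of x y z h j] mixed_triples.xyz[of y x z h j] assms(1)
      by (intro all_triplesI(3)[of _ h]) auto
  qed
qed

lemma in_points_cases:
  assumes "p \<in> points"
  obtains l where "p = Inf l" | h i x where "p = Pt h i x" "x \<in> {0..<2*n}"
  using assms unfolding points_def by (cases p) auto

text \<open>For the harder inclusion, triples are sorted by their number of points at infinity: two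
  in \<open>two\<close>, at least one in \<open>one\<close>, none in
  \<open>triple_no_stem\<close>.\<close>

lemma all_triples_eq: "all_triples = {T. T \<subseteq> points \<and> card T = 3}"
proof (intro equalityI subsetI)
  fix T assume "T \<in> all_triples"
  then consider (g) h i where "T \<in> group_triples h i" | (p) h where "T \<in> pair_triples h"
    | (m) h where "T \<in> mixed_triples h"
    unfolding all_triples_def by blast
  then show "T \<in> {T. T \<subseteq> points \<and> card T = 3}"
  proof cases
    case g
    then show ?thesis unfolding group_triples_def points_def by blast
  next
    case p
    then show ?thesis by cases (auto simp: points_def)
  next
    case m
    then show ?thesis by cases (auto simp: points_def)
  qed
next
  fix T assume "T \<in> {T. T \<subseteq> points \<and> card T = 3}"
  then obtain p q r where T: "T = {p,q,r}" and d: "p \<noteq> q" "q \<noteq> r" "p \<noteq> r"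
    and pts: "p \<in> points" "q \<in> points" "r \<in> points"
    by (auto simp: card_3_iff)
  have two: "{Inf l, Inf l', p} \<in> all_triples" if "p \<in> points" "card {Inf l, Inf l', p} = 3" for l l' p
    using that(1)
  proof (cases rule: in_points_cases)
    case (1 l'')
    have "card {Inf l, Inf l', p} \<le> card stem" by (intro card_mono) (auto simp: stem_def 1)
    then show ?thesis using that(2) by (simp add: stem_def)
  next
    case (2 h i x)
    then show ?thesis using that(2) by (intro all_triplesI(1)[of _ h i]) auto
  qed
  have one: "{Inf l, p, q} \<in> all_triples"
    if "p \<in> points" "q \<in> points" "card {Inf l, p, q} = 3" for l p q
    using that(1)
  proof (cases rule: in_points_cases)
    case (1 l')
    then show ?thesis using two[of q l l'] that by simp
  next
    case p: (2 h i x)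
    show ?thesis using that(2)
    proof (cases rule: in_points_cases)
      case (1 l')
      then have "{Inf l, p, q} = {Inf l, Inf l', p}" by auto
      then show ?thesis using two[of p l l'] that by simp
    next
      case (2 h' j y)
      moreover have "p \<noteq> q" using that(3) by (auto simp: card_insert_if split: if_splits)
      ultimately show ?thesis using p triple_stem[of h i x h' j y l] by simp
    qed
  qed
  have card: "card {p,q,r} = 3" using d by simp
  show "T \<in> all_triples"
  proof (cases "\<exists>l. p = Inf l \<or> q = Inf l \<or> r = Inf l")
    case True
    then obtain l where "p = Inf l \<or> q = Inf l \<or> r = Inf l" by blast
    moreover have "{p,q,r} = {q,p,r}" "{p,q,r} = {r,p,q}" by auto
    ultimately show ?thesis using one[of q r l] one[of p r l] one[of p q l] pts card T by metis
  next
    case False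
    obtain h i x where p: "p = Pt h i x" "x \<in> {0..<2*n}" using pts(1) False by (metis in_points_cases)
    obtain h' i' y where q: "q = Pt h' i' y" "y \<in> {0..<2*n}" using pts(2) False by (metis in_points_cases)
    obtain h'' i'' z where r: "r = Pt h'' i'' z" "z \<in> {0..<2*n}" using pts(3) False by (metis in_points_cases)
    \<comment> \<open>The first bit takes two values, so two of the three points share it; they are
      moved to the front.\<close>
    consider "h' = h" | "h'' = h" | "h'' = h'" by blast
    then show ?thesis
    proof cases
      case 1
      then show ?thesis using triple_no_stem[of x y z h i i' h'' i''] p q r T card by simp
    next
      case 2
      have "T = {p,r,q}" using T by auto
      then show ?thesis using 2 triple_no_stem[of x z y h i i'' h' i'] p q r T card by simp
    next
      case 3
      have "T = {q,r,p}" using T by auto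
      then show ?thesis using 3 triple_no_stem[of y z x h' i' i'' h i] p q r T card by simp
    qed
  qed
qed

section \<open>Blocks on two groups with the same first bit\<close>

definition "pair_block h x x' y y' = {Pt h False x, Pt h False x', Pt h True y, Pt h True y'}"

definition "pair_blocks h S = {pair_block h x x' y y' | x x' y y'. S x x' y y'}"

lemma pair_block_sym:
  "pair_block h x' x y y' = pair_block h x x' y y'" "pair_block h x x' y' y = pair_block h x x' y y'"
  unfolding pair_block_def by auto

lemma subset_pair_block_False:
  "x \<noteq> x' \<Longrightarrow> {Pt h False x, Pt h False x', Pt h True y} \<subseteq> pair_block h a a' b b' \<longleftrightarrow>
   (a = x \<and> a' = x' \<or> a = x' \<and> a' = x) \<and> (b = y \<or> b' = y)"
  unfolding pair_block_def by auto

lemma subset_pair_block_True: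
  "y \<noteq> y' \<Longrightarrow> {Pt h True y, Pt h True y', Pt h False x} \<subseteq> pair_block h a a' b b' \<longleftrightarrow>
   (b = y \<and> b' = y' \<or> b = y' \<and> b' = y) \<and> (a = x \<or> a' = x)"
  unfolding pair_block_def by auto

text \<open>A triple with two points in \<open>(h, False)\<close> is completed by the second axiom
  of \<open>biquad\<close>, one with two points in \<open>(h, True)\<close> by the third.\<close>

lemma covers_pair:
  assumes S: "biquad {0..<2*n} {0..<2*n} S"
  shows "covers (pair_blocks h S) (pair_triples h)"
  unfolding covers_def
proof (intro conjI ballI allI impI)
  fix b T assume "b \<in> pair_blocks h S" and T: "T \<subseteq> b \<and> card T = 3"
  then obtain x x' y y' where i: "S x x' y y'" and b: "b = pair_block h x x' y y'"
    unfolding pair_blocks_def by blast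
  have Z: "{x,x',y,y'} \<subseteq> {0..<2*n}" and d: "x \<noteq> x'" "y \<noteq> y'" using biquadD(1)[OF S i] by auto
  have "T = {Pt h False x, Pt h False x', Pt h True y} \<or> T = {Pt h False x, Pt h False x', Pt h True y'} \<or>
      T = {Pt h True y, Pt h True y', Pt h False x} \<or> T = {Pt h True y, Pt h True y', Pt h False x'}"
    using card_3_subset_4[of T "Pt h False x" "Pt h False x'" "Pt h True y" "Pt h True y'"] T d
    unfolding b pair_block_def by (auto simp: insert_commute)
  then show "T \<in> pair_triples h"
    using Z d pair_triples.intros[of x x' y h False] pair_triples.intros[of x x' y' h False]
      pair_triples.intros[of y y' x h True] pair_triples.intros[of y y' x' h True] by auto
next
  fix T assume T: "T \<in> pair_triples h"
  then show "card T = 3" by cases auto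
  have ex1: "\<exists>!b. b \<in> pair_blocks h S \<and> T \<subseteq> b"
    if "S x x' y y'" "T \<subseteq> pair_block h x x' y y'"
      and uniq: "\<And>a a' b b'. \<lbrakk>S a a' b b'; T \<subseteq> pair_block h a a' b b'\<rbrakk> \<Longrightarrow>
        (a = x \<and> a' = x' \<or> a = x' \<and> a' = x) \<and> (b = y \<and> b' = y' \<or> b = y' \<and> b' = y)" for x x' y y'
  proof (rule ex1I[of _ "pair_block h x x' y y'"])
    show "pair_block h x x' y y' \<in> pair_blocks h S \<and> T \<subseteq> pair_block h x x' y y'"
      using that(1,2) unfolding pair_blocks_def by blast
    show "c = pair_block h x x' y y'" if mem: "c \<in> pair_blocks h S \<and> T \<subseteq> c" for c
    proof -
      obtain a a' b b' where c: "c = pair_block h a a' b b'" "S a a' b b'"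
        using mem unfolding pair_blocks_def by blast
      then have "(a = x \<and> a' = x' \<or> a = x' \<and> a' = x) \<and> (b = y \<and> b' = y' \<or> b = y' \<and> b' = y)"
        using uniq[OF c(2)] mem by simp
      then show ?thesis using c(1) pair_block_sym by (elim conjE disjE) metis+
    qed
  qed
  from T show "\<exists>!b. b \<in> pair_blocks h S \<and> T \<subseteq> b"
  proof cases
    case (1 u u' v i)
    show ?thesis
    proof (cases i)
      case False
      note sub = subset_pair_block_False[OF 1(3), of h v]
      have T': "T = {Pt h False u, Pt h False u', Pt h True v}" using 1(1) False by simp
      obtain v' where v': "S u u' v v'" "\<And>w. S u u' v w \<Longrightarrow> w = v'"
        using biquadD(2)[OF S, of u u' v] 1 by auto
      show ?thesis
      proof (rule ex1[OF v'(1)]; unfold T' sub)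
        fix a a' b b'
        assume S': "S a a' b b'" and "(a = u \<and> a' = u' \<or> a = u' \<and> a' = u) \<and> (b = v \<or> b' = v)"
        \<comment> \<open>The given points may occupy either place in their pairs, so every order of
          the block is compared with the solution \<open>v'\<close>.\<close>
        moreover have "S a' a b b'" "S a a' b' b" "S a' a b' b"
          using biquadD(1)[OF S] S' by blast+
        ultimately show "(a = u \<and> a' = u' \<or> a = u' \<and> a' = u) \<and> (b = v \<and> b' = v' \<or> b = v' \<and> b' = v)"
          using v'(2) by blast
      qed simp
    next
      case True
      note sub = subset_pair_block_True[OF 1(3), of h v]
      have T': "T = {Pt h True u, Pt h True u', Pt h False v}" using 1(1) True by simp
      obtain v' where v': "S v v' u u'" "\<And>w. S v w u u' \<Longrightarrow> w = v'"
        using biquadD(3)[OF S, of v u u'] 1 by auto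
      show ?thesis
      proof (rule ex1[OF v'(1)]; unfold T' sub)
        fix a a' b b'
        assume S': "S a a' b b'" and "(b = u \<and> b' = u' \<or> b = u' \<and> b' = u) \<and> (a = v \<or> a' = v)"
        moreover have "S a' a b b'" "S a a' b' b" "S a' a b' b"
          using biquadD(1)[OF S] S' by blast+
        ultimately show "(a = v \<and> a' = v' \<or> a = v' \<and> a' = v) \<and> (b = u \<and> b' = u' \<or> b = u' \<and> b' = u)"
          using v'(2) by blast
      qed simp
    qed
  qed
qed

section \<open>Assembling the design and counting its points\<close>

definition "all_blocks G S = (\<Union>(h, i)\<in>UNIV. G h i) \<union>
  ((\<Union>h. pair_blocks h S) \<union> (\<Union>h. mixed_blocks h))"

lemma covers_all_blocks:
  assumes W: "\<And>h i. wbd3 (stem \<union> grp h i) K (G h i)"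
    and S: "biquad {0..<2*n} {0..<2*n} S"
  shows "covers (all_blocks G S) all_triples"
  unfolding all_blocks_def all_triples_def
proof (intro covers_Un)
  have "covers (G h i) (group_triples h i)" for h i
    using wbd3_covers[OF W] by (simp add: group_triples_def)
  then show "covers (\<Union>(h, i)\<in>UNIV. G h i) (\<Union>(h, i)\<in>UNIV. group_triples h i)"
  proof (intro covers_UN)
    fix k l :: "bool \<times> bool" assume "k \<noteq> l"
    then show "(case k of (h, i) \<Rightarrow> group_triples h i) \<inter> (case l of (h, i) \<Rightarrow> group_triples h i) = {}"
      using group_triples_disjoint by (cases k; cases l) simp
  qed auto
  show "covers (\<Union>h. pair_blocks h S) (\<Union>h. pair_triples h)"
    using covers_pair[OF S] pair_triples_disjoint by (intro covers_UN) auto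
  show "covers (\<Union>h. mixed_blocks h) (\<Union>h. mixed_triples h)"
    using covers_mixed mixed_triples_disjoint by (intro covers_UN) auto
  show "(\<Union>h. pair_triples h) \<inter> (\<Union>h. mixed_triples h) = {}"
    using pair_mixed_disjoint by blast
  show "(\<Union>(h, i)\<in>UNIV. group_triples h i) \<inter> ((\<Union>h. pair_triples h) \<union> (\<Union>h. mixed_triples h)) = {}"
    using group_pair_disjoint group_mixed_disjoint by fast
qed

lemma points_eq:
  "points = stem \<union> (\<lambda>(h, i, x). Pt h i x) ` (UNIV \<times> UNIV \<times> {0..<2*n})"
proof -
  have "(\<Union>h. \<Union>i. grp h i) = (\<lambda>(h, i, x). Pt h i x) ` (UNIV \<times> UNIV \<times> {0..<2*n})"
  proof (intro equalityI subsetI)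
    fix p assume "p \<in> (\<Union>h. \<Union>i. grp h i)"
    then obtain h i x where "p = Pt h i x" "x \<in> {0..<2*n}" unfolding grp_def by blast
    then show "p \<in> (\<lambda>(h, i, x). Pt h i x) ` (UNIV \<times> UNIV \<times> {0..<2*n})"
      by (intro image_eqI[of _ _ "(h, i, x)"]) simp_all
  qed auto
  then show ?thesis by (simp add: points_def)
qed

lemma finite_points: "finite points"
  unfolding points_eq stem_def by simp

lemma card_points: "card points = 8 * nat n + 2"
proof -
  let ?P = "(\<lambda>(h, i, x). Pt h i x) ` (UNIV \<times> UNIV \<times> {0..<2*n})"
  have "card ?P = card ((UNIV :: bool set) \<times> (UNIV :: bool set) \<times> {0..<2*n})"
    by (intro card_image) (auto simp: inj_on_def)
  also have "\<dots> = 8 * nat n" by (simp add: card_cartesian_product nat_mult_distrib)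
  finally have "card ?P = 8 * nat n" .
  moreover have "stem \<inter> ?P = {}" by (auto simp: stem_def)
  moreover have "card stem = 2" "finite stem" by (simp_all add: stem_def)
  moreover have "finite ?P" by simp
  ultimately show ?thesis unfolding points_eq using card_Un_disjoint[of stem ?P] by simp
qed

lemma card_stem_grp: "card (stem \<union> grp h i) = 2 * nat n + 2" "finite (stem \<union> grp h i)"
proof -
  have "card (grp h i) = 2 * nat n"
    unfolding grp_def by (subst card_image) (auto simp: inj_on_def nat_mult_distrib)
  moreover have "stem \<inter> grp h i = {}" "card stem = 2" "finite stem" "finite (grp h i)"
    by (auto simp: stem_def grp_def)
  ultimately show "card (stem \<union> grp h i) = 2 * nat n + 2" "finite (stem \<union> grp h i)"
    by (simp_all add: card_Un_disjoint)
qed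

text \<open>Pair blocks and mixed blocks have size 4, so any other block size can only come from the
  designs \<open>G h i\<close>. A general \<open>K\<close> thus serves quadruple systems and sizes 4
  and 6 alike.\<close>

lemma wbd3_all_blocks:
  assumes W: "\<And>h i. wbd3 (stem \<union> grp h i) K (G h i)"
    and S: "biquad {0..<2*n} {0..<2*n} S" and K: "4 \<in> K"
  shows "wbd3 points K (all_blocks G S)"
proof (rule covers_wbd3)
  show "finite points" by (rule finite_points)
  show "covers (all_blocks G S) {T. T \<subseteq> points \<and> card T = 3}"
    using covers_all_blocks[OF W S] by (simp add: all_triples_eq)
  fix b assume "b \<in> all_blocks G S"
  then consider (g) h i where "b \<in> G h i" | (p) h x x' y y' where "b = pair_block h x x' y y'" "S x x' y y'"
    | (m) h x y j z w where "b = mixed_block h x y j z w" "inc h x y j z w"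
    unfolding all_blocks_def pair_blocks_def mixed_blocks_def by blast
  then have "b \<subseteq> points \<and> card b \<in> K"
  proof cases
    case g
    then have "b \<subseteq> stem \<union> grp h i" "card b \<in> K" using W[of h i] by (simp_all add: wbd3_def)
    then show ?thesis unfolding points_def by blast
  next
    case p
    have d: "{x,x',y,y'} \<subseteq> {0..<2*n}" "x \<noteq> x'" "y \<noteq> y'" using biquadD(1)[OF S p(2)] by auto
    then have "b \<subseteq> points" unfolding p pair_block_def points_def by auto
    moreover have "card b = 4" using d unfolding p pair_block_def by simp
    ultimately show ?thesis using K by simp
  next
    case m
    then have "{x,y,z,w} \<subseteq> {0..<2*n}" by (simp add: inc_def)
    then have "b \<subseteq> points" unfolding m mixed_block_def points_def by auto
    moreover have "card b = 4" unfolding m mixed_block_def by auto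
    ultimately show ?thesis using K by simp
  qed
  then show "b \<subseteq> points" "card b \<in> K" by simp_all
qed

end

section \<open>The embedding\<close>

text \<open>The 3-BBD is one of the copies inside its own quadrupled system, so carrying that system
  over to the groups \<open>(False, False)\<close> and \<open>(False, True)\<close> embeds
  it.\<close>

lemma BBD3_embeds_pair_blocks:
  assumes n: "n > 0" and B: "BBD3 (nat n) X g1 g2 B"
  obtains S where "biquad {0..<2*n} {0..<2*n} S"
    "embeds X B (hanani.points n) (hanani.pair_blocks False S)"
proof -
  interpret hanani n by unfold_locales (rule n)
  have X: "finite X" "card X = nat n" "g1 \<union> g2 = X" "g1 \<inter> g2 = {}" "card g1 = card g2"
    and blocks: "\<And>b. b \<in> B \<Longrightarrow> b \<subseteq> X \<and> card (b \<inter> g1) = 2 \<and> card (b \<inter> g2) = 2"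
    using B by (simp_all add: BBD3_def)
  have fin: "finite g1" "finite g2" using X by auto
  have "card X = card g1 + card g2" using card_Un_disjoint[OF fin] X by simp
  \<comment> \<open>Each part has half of the \<open>n\<close> points, so four copies of a part have
    \<open>2*n\<close> points, the size of a group.\<close>
  then have n2: "nat n = 2 * card g1" using X by simp
  define m where "m = int (card g1)"
  have m: "m > 0" using n n2 by (simp add: m_def)
  have "\<exists>e. bij_betw e g1 {0..<m}" "\<exists>f. bij_betw f g2 {0..<m}"
    by (rule finite_same_card_bij; simp add: fin m_def X(5))+
  then obtain e f where e: "bij_betw e g1 {0..<m}" and f: "bij_betw f g2 {0..<m}" by blast
  let ?R = "bbd_rel g1 g2 B"
  let ?Q = "quadruple_rel g1 g2 ?R m e f"
  have Q: "biquad (UNIV \<times> g1) (UNIV \<times> g2) ?Q"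
    by (rule biquad_quadruple[OF BBD3_biquad[OF B] e f m])
  have c4: "card (UNIV :: (bool \<times> bool) set) = 4"
    unfolding UNIV_Times_UNIV[symmetric] card_cartesian_product card_UNIV_bool by simp
  have cards: "card ((UNIV :: (bool \<times> bool) set) \<times> g1) = card {0..<2*n}"
    "card ((UNIV :: (bool \<times> bool) set) \<times> g2) = card {0..<2*n}"
    unfolding card_cartesian_product c4 using n2 X(5) by (simp_all add: nat_mult_distrib)
  have "\<exists>p. bij_betw p {0..<2*n} ((UNIV :: (bool \<times> bool) set) \<times> g1)"
    "\<exists>q. bij_betw q {0..<2*n} ((UNIV :: (bool \<times> bool) set) \<times> g2)"
    by (rule finite_same_card_bij; simp add: fin cards)+
  then obtain p q where p: "bij_betw p {0..<2*n} ((UNIV :: (bool \<times> bool) set) \<times> g1)"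
    and q: "bij_betw q {0..<2*n} ((UNIV :: (bool \<times> bool) set) \<times> g2)" by blast
  let ?S = "\<lambda>a a' b b'. {a,a'} \<subseteq> {0..<2*n} \<and> {b,b'} \<subseteq> {0..<2*n} \<and> ?Q (p a) (p a') (q b) (q b')"
  have S: "biquad {0..<2*n} {0..<2*n} ?S" by (rule biquad_vimage[OF Q p q])
  \<comment> \<open>The copy that receives the given 3-BBD; inside a single copy
    \<open>quadruple_rel\<close> reduces to \<open>bbd_rel\<close>.\<close>
  let ?o = "(False, False)"
  define p' where "p' x = inv_into {0..<2*n} p (?o, x)" for x
  define q' where "q' x = inv_into {0..<2*n} q (?o, x)" for x
  have p': "p (p' x) = (?o, x)" "p' x \<in> {0..<2*n}" if "x \<in> g1" for x
  proof -
    have "(?o, x) \<in> p ` {0..<2*n}" unfolding bij_betw_imp_surj_on[OF p] using that by blast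
    then show "p (p' x) = (?o, x)" "p' x \<in> {0..<2*n}"
      unfolding p'_def by (rule f_inv_into_f, rule inv_into_into)
  qed
  have q': "q (q' x) = (?o, x)" "q' x \<in> {0..<2*n}" if "x \<in> g2" for x
  proof -
    have "(?o, x) \<in> q ` {0..<2*n}" unfolding bij_betw_imp_surj_on[OF q] using that by blast
    then show "q (q' x) = (?o, x)" "q' x \<in> {0..<2*n}"
      unfolding q'_def by (rule f_inv_into_f, rule inv_into_into)
  qed
  let ?f = "\<lambda>x. if x \<in> g1 then Pt False False (p' x) else Pt False True (q' x)"
  have f1: "?f x = Pt False False (p' x)" if "x \<in> g1" for x using that by simp
  have f2: "?f x = Pt False True (q' x)" if "x \<in> g2" for x using that X(4) by auto
  have p'inj: "x = y" if "x \<in> g1" "y \<in> g1" "p' x = p' y" for x y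
    using p'(1)[OF that(1)] p'(1)[OF that(2)] unfolding that(3) by (metis prod.inject)
  have q'inj: "x = y" if "x \<in> g2" "y \<in> g2" "q' x = q' y" for x y
    using q'(1)[OF that(1)] q'(1)[OF that(2)] unfolding that(3) by (metis prod.inject)
  have "embeds X B points (pair_blocks False ?S)"
    unfolding embeds_def
  proof (intro exI conjI ballI)
    show "inj_on ?f X"
    proof (rule inj_onI)
      fix x y assume xy: "x \<in> X" "y \<in> X" "?f x = ?f y"
      then have "x \<in> g1 \<longleftrightarrow> y \<in> g1" by (simp split: if_splits)
      then consider "x \<in> g1" "y \<in> g1" | "x \<in> g2" "y \<in> g2" using xy(1,2) X(3) by blast
      then show "x = y"
      proof cases
        case 1
        then show ?thesis using p'inj xy(3) by simp
      next
        case 2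
        then have "q' x = q' y" using xy(3) unfolding f2[OF 2(1)] f2[OF 2(2)] by simp
        then show ?thesis using q'inj 2 by simp
      qed
    qed
    show "?f ` X \<subseteq> points"
    proof
      fix y assume "y \<in> ?f ` X"
      then obtain x where x: "x \<in> X" "y = ?f x" by blast
      then consider "x \<in> g1" | "x \<in> g2" using X(3) by blast
      then have "y \<in> grp False False \<or> y \<in> grp False True"
      proof cases
        case 1
        then show ?thesis using p'(2)[OF 1] x(2) by simp
      next
        case 2
        then show ?thesis using q'(2)[OF 2] unfolding x(2) f2[OF 2] by simp
      qed
      then show "y \<in> points" unfolding points_def by blast
    qed
    fix b assume b: "b \<in> B"
    obtain a a' where a: "b \<inter> g1 = {a,a'}" "a \<noteq> a'" using blocks[OF b] by (auto simp: card_2_iff)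
    obtain c c' where c: "b \<inter> g2 = {c,c'}" "c \<noteq> c'" using blocks[OF b] by (auto simp: card_2_iff)
    have "b = (b \<inter> g1) \<union> (b \<inter> g2)" using blocks[OF b] X(3) by blast
    then have beq: "b = {a,a',c,c'}" unfolding a(1) c(1) by auto
    have mem: "a \<in> g1" "a' \<in> g1" "c \<in> g2" "c' \<in> g2" using a c by auto
    have "?R a a' c c'" unfolding bbd_rel_def using b beq mem a(2) c(2) by simp
    then have "?S (p' a) (p' a') (q' c) (q' c')"
      using p' q' mem by (simp add: quadruple_rel_def bdiff_def)
    moreover have "?f ` b = pair_block False (p' a) (p' a') (q' c) (q' c')"
      unfolding beq pair_block_def image_insert image_empty
        f1[OF mem(1)] f1[OF mem(2)] f2[OF mem(3)] f2[OF mem(4)] ..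
    ultimately show "?f ` b \<in> pair_blocks False ?S"
      unfolding pair_blocks_def by blast
  qed
  then show thesis by (rule that[OF S])
qed

lemma embeds_mono: "embeds X B Y C \<Longrightarrow> C \<subseteq> D \<Longrightarrow> embeds X B Y D"
  unfolding embeds_def by (meson subsetD)

text \<open>Both claims of the theorem in one: \<open>K\<close> is \<open>{4}\<close> for the first
  and \<open>{4,6}\<close> for the second.\<close>

lemma wbd3_BBD3_embedding:
  fixes N :: nat
  assumes N: "N > 0" and W: "wbd3 X1 K B1" "card X1 = 2*N+2" and K: "4 \<in> K"
    and B: "BBD3 N X2 g1 g2 B2"
  shows "\<exists>(Y::nat set) C. card Y = 8*N+2 \<and> wbd3 Y K C \<and> embeds X1 B1 Y C \<and> embeds X2 B2 Y C"
proof -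
  define n where "n = int N"
  have n: "n > 0" "nat n = N" using N by (simp_all add: n_def)
  interpret hanani n by unfold_locales (rule n)
  obtain S where S: "biquad {0..<2*n} {0..<2*n} S" "embeds X2 B2 points (pair_blocks False S)"
    using BBD3_embeds_pair_blocks[of n X2 g1 g2 B2] n B by auto
  have "finite X1" using W(1) by (simp add: wbd3_def)
  \<comment> \<open>The four bijections may send different points of \<open>X1\<close> to the stem:
    no triple fits into the stem, so the four copies never compete for one.\<close>
  then have "\<exists>f. bij_betw f X1 (stem \<union> grp h i)" for h i
    using card_stem_grp n W(2) by (intro finite_same_card_bij) simp_all
  then obtain f where f: "\<And>h i. bij_betw (f h i) X1 (stem \<union> grp h i)" by metis
  define G where "G h i = (`) (f h i) ` B1" for h i
  have G: "wbd3 (stem \<union> grp h i) K (G h i)" for h i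
    using wbd3_image[OF W(1), of "f h i"] f[of h i] by (simp add: G_def bij_betw_def)
  have P: "wbd3 points K (all_blocks G S)" by (rule wbd3_all_blocks[OF G S(1) K])
  have "embeds X1 B1 points (G False False)"
    unfolding embeds_def
  proof (intro exI conjI ballI)
    show "inj_on (f False False) X1" using f by (auto simp: bij_betw_def)
    have "f False False ` X1 = stem \<union> grp False False" using f by (simp add: bij_betw_def)
    then show "f False False ` X1 \<subseteq> points" unfolding points_def by auto
  qed (simp add: G_def)
  then have E1: "embeds X1 B1 points (all_blocks G S)"
    by (rule embeds_mono) (auto simp: all_blocks_def)
  have E2: "embeds X2 B2 points (all_blocks G S)"
    by (rule embeds_mono[OF S(2)]) (auto simp: all_blocks_def)
  \<comment> \<open>The conclusion asks for a design on natural numbers, so the finite set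
    \<open>points\<close> is renamed injectively.\<close>
  obtain g :: "pt \<Rightarrow> nat" where g: "inj_on g points"
    using finite_imp_inj_to_nat_seg[OF finite_points] by blast
  let ?C = "(`) g ` all_blocks G S"
  have "embeds points (all_blocks G S) (g ` points) ?C"
    unfolding embeds_def using g by blast
  moreover have "card (g ` points) = 8*N+2" using card_image[OF g] card_points n by simp
  ultimately show ?thesis
    using wbd3_image[OF P g] embeds_trans[OF E1] embeds_trans[OF E2] by blast
qed

theorem theorem3:
  fixes n :: nat
    and X1 :: "'a set" and B1 :: "'a set set"
    and X2 :: "'b set" and g1 g2 :: "'b set" and B2 :: "'b set set"
    and X3 :: "'c set" and B3 :: "'c set set"
  assumes "n > 75" and "even n"
  shows "(SQS (2*n+2) X1 B1 \<and> BBD3 n X2 g1 g2 B2 \<longrightarrow>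
            (\<exists>(Y::nat set) C. SQS (8*n+2) Y C \<and> embeds X1 B1 Y C \<and> embeds X2 B2 Y C))
       \<and> (S346 (2*n+2) X3 B3 \<and> BBD3 n X2 g1 g2 B2 \<longrightarrow>
            (\<exists>(Y::nat set) C. S346 (8*n+2) Y C \<and> embeds X3 B3 Y C \<and> embeds X2 B2 Y C))"
  using wbd3_BBD3_embedding[of n X1 "{4}" B1 X2 g1 g2 B2] wbd3_BBD3_embedding[of n X3 "{4,6}" B3 X2 g1 g2 B2]
    assms(1) unfolding SQS_def S346_def by auto

end
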